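(* The following hold. 1. For every asteroidal triple-free graph $G$, we have $\gamma(G)\le 3\cdot\rho(G)$. 2. For every convex graph $G$, we have $\gamma(G)\le 3\cdot\rho(G)$. 3. For every unit-disk graph $G$, we have $\gamma(G)\le 32\cdot\rho(G)$.
   Context: All graphs are finite and simple. For a vertex $v$ of a graph $G$, $N_G[v]$ denotes the closed neighborhood of $v$. A dominating set of $G$ is a set of vertices whose closed neighborhoods together cover $V(G)$; $\gamma(G)$ denotes the minimum size of a dominating set. A packing in $G$ is a set of vertices whose closed neighborhoods are pairwise disjoint (equivalently, pairwise at distance at least $3$); $\rho(G)$ denotes the maximum size of a packing. An asteroidal triple in a graph $G$ is a set $T$ of $3$ vertices such that $G[T]$ is independent and every pair of vertices in $T$ can be joined by a path that avoids the neighborhood of the third vertex of $T$. A graph is asteroidal triple-free if it contains no asteroidal triple. A bipartite graph $G=(X\cup Y,E)$ is convex if one of the color classes, without loss of generality $X$, has a linear ordering such that for every $y\in Y$ the vertices adjacent to $y$ are consecutive in the ordering. A unit-disk graph is the intersection graph of a finite collection of (closed) disks of radius $1$ in the plane: the vertices are the disks, and two distinct vertices are adjacent if and only if the corresponding disks intersect. *)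

theory Defs
  imports "HOL-Analysis.Analysis" "Graph_Theory.Graph_Theory"
begin

text \<open>
  A finite simple graph is a \<^term>\<open>G\<close> with \<^prop>\<open>graph G\<close>: a finite symmetric digraph without
  loops and multiple arcs. Vertices \<^term>\<open>u\<close> and \<^term>\<open>v\<close> are adjacent iff
  \<^term>\<open>u \<rightarrow>\<^bsub>G\<^esub> v\<close>. The vertex set may be empty.
\<close>

definition closed_nbhd :: "('a, 'b) pre_digraph \<Rightarrow> 'a \<Rightarrow> 'a set" where
  "closed_nbhd G v = insert v {u \<in> verts G. v \<rightarrow>\<^bsub>G\<^esub> u}"

definition dominating_set :: "('a, 'b) pre_digraph \<Rightarrow> 'a set \<Rightarrow> bool" where
  "dominating_set G D \<longleftrightarrow> D \<subseteq> verts G \<and> (\<Union>v\<in>D. closed_nbhd G v) = verts G"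

definition packing :: "('a, 'b) pre_digraph \<Rightarrow> 'a set \<Rightarrow> bool" where
  "packing G P \<longleftrightarrow> P \<subseteq> verts G \<and> disjoint_family_on (closed_nbhd G) P"

text \<open>
  For a finite \<^term>\<open>G\<close> both sets below are finite and nonempty (witnessed by \<^term>\<open>verts G\<close>
  and \<^term>\<open>{}\<close>), so \<^const>\<open>Min\<close> and \<^const>\<open>Max\<close> are attained.
\<close>

definition domination_number :: "('a, 'b) pre_digraph \<Rightarrow> nat" where
  "domination_number G = Min {card D | D. dominating_set G D}"

definition packing_number :: "('a, 'b) pre_digraph \<Rightarrow> nat" where
  "packing_number G = Max {card P | P. packing G P}"

definition independent_set :: "('a, 'b) pre_digraph \<Rightarrow> 'a set \<Rightarrow> bool" where
  "independent_set G S \<longleftrightarrow> S \<subseteq> verts G \<and> (\<forall>u\<in>S. \<forall>v\<in>S. \<not> u \<rightarrow>\<^bsub>G\<^esub> v)"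

definition joined_avoiding :: "('a, 'b) pre_digraph \<Rightarrow> 'a set \<Rightarrow> 'a \<Rightarrow> 'a \<Rightarrow> bool" where
  "joined_avoiding G S u v \<longleftrightarrow> (\<exists>p. vpath p G \<and> hd p = u \<and> last p = v \<and> set p \<inter> S = {})"

text \<open>
  Avoiding the closed or the open neighbourhood of the third vertex \<^term>\<open>w\<close> makes no difference:
  a path between two vertices other than \<^term>\<open>w\<close> that visits \<^term>\<open>w\<close> also visits one of its
  neighbours.
\<close>

definition asteroidal_triple :: "('a, 'b) pre_digraph \<Rightarrow> 'a set \<Rightarrow> bool" where
  "asteroidal_triple G T \<longleftrightarrow> card T = 3 \<and> independent_set G T \<and>
     (\<forall>u\<in>T. \<forall>v\<in>T. \<forall>w\<in>T. u \<noteq> v \<and> u \<noteq> w \<and> v \<noteq> w \<longrightarrow>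
        joined_avoiding G (closed_nbhd G w) u v)"

definition asteroidal_triple_free :: "('a, 'b) pre_digraph \<Rightarrow> bool" where
  "asteroidal_triple_free G \<longleftrightarrow> \<not> (\<exists>T. asteroidal_triple G T)"

definition bipartition :: "('a, 'b) pre_digraph \<Rightarrow> 'a set \<Rightarrow> 'a set \<Rightarrow> bool" where
  "bipartition G X Y \<longleftrightarrow> X \<union> Y = verts G \<and> X \<inter> Y = {} \<and>
     independent_set G X \<and> independent_set G Y"

text \<open>\<^prop>\<open>(a, b) \<in> r\<close> stands for ``\<open>a\<close> is at most \<open>b\<close>''.\<close>

definition consecutive_in :: "('a \<times> 'a) set \<Rightarrow> 'a set \<Rightarrow> 'a set \<Rightarrow> bool" where
  "consecutive_in r X S \<longleftrightarrow>
     (\<forall>a\<in>S. \<forall>c\<in>S. \<forall>b\<in>X. (a, b) \<in> r \<and> (b, c) \<in> r \<longrightarrow> b \<in> S)"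

definition convex_graph :: "('a, 'b) pre_digraph \<Rightarrow> bool" where
  "convex_graph G \<longleftrightarrow> (\<exists>X Y r. bipartition G X Y \<and> linear_order_on X r \<and>
     (\<forall>y\<in>Y. consecutive_in r X {x \<in> X. y \<rightarrow>\<^bsub>G\<^esub> x}))"

text \<open>
  The vertex \<^term>\<open>v\<close> represents the disk with centre \<open>c v\<close>; \<open>c\<close> need not be injective, so
  the collection of disks may contain repetitions.
\<close>

definition unit_disk_graph :: "('a, 'b) pre_digraph \<Rightarrow> bool" where
  "unit_disk_graph G \<longleftrightarrow> (\<exists>c :: 'a \<Rightarrow> real ^ 2. \<forall>u\<in>verts G. \<forall>v\<in>verts G.
     u \<rightarrow>\<^bsub>G\<^esub> v \<longleftrightarrow> u \<noteq> v \<and> cball (c u) 1 \<inter> cball (c v) 1 \<noteq> {})"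

end

theory Submission
  imports Defs
begin

text \<open>
  All three bounds come from one greedy scheme (\<open>greedy_domination\<close>). Keep a set \<open>U\<close> of vertices
  that remain to be dominated, and repeatedly find a packing \<open>P \<subseteq> U\<close> and a set \<open>D\<close> with
  \<open>|D| \<le> c |P|\<close> such that \<open>D\<close> dominates every vertex removed from \<open>U\<close> in this round, while the
  closed neighbourhoods of the vertices that stay in \<open>U\<close> miss those of \<open>P\<close>. The packings of all
  rounds then unite to a packing, and \<open>\<gamma>(G) \<le> c \<rho>(G)\<close>.

  For convex and unit-disk graphs \<open>P\<close> is a single vertex that is extremal in \<open>U\<close>, and the vertices of
  \<open>U\<close> within distance two of it have to be dominated. In a convex graph take the vertex whose
  rightmost neighbour (the vertex itself, if it is in the ordered class) comes first, or a vertex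
  without neighbours if there is one; two dominators suffice. In a unit-disk graph take the leftmost centre: the vertices in question have their centres
  in a rectangle of size \<open>4 \<times> 8\<close>, which is covered by \<open>3 \<times> 6\<close> square cells of diameter less than two,
  and one vertex per cell dominates.

  For asteroidal triple-free graphs a round removes a connected component \<open>K\<close>. The point is that \<open>K\<close>
  contains a dominating pair \<open>x, y\<close>, that is, every walk from \<open>x\<close> to \<open>y\<close> dominates \<open>K\<close>
  (\<open>ex_pokable\<close> and \<open>pokable_imp_dominating_pair\<close>). A shortest path with \<open>n\<close> edges between them gives a
  dominating set of size at most \<open>n + 1\<close>, and every third vertex of it gives a packing of size
  \<open>n div 3 + 1\<close>.
\<close>

section \<open>Closed neighbourhoods and the greedy scheme\<close>

lemma (in graph) adj_sym: "u \<rightarrow>\<^bsub>G\<^esub> v \<Longrightarrow> v \<rightarrow>\<^bsub>G\<^esub> u"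
  using sym_arcs by (auto simp: symmetric_def sym_def)

lemma (in graph) mem_closed_nbhd_iff: "u \<in> closed_nbhd G v \<longleftrightarrow> u = v \<or> v \<rightarrow>\<^bsub>G\<^esub> u"
  using adj_in_verts by (auto simp: closed_nbhd_def)

lemma (in graph) closed_nbhd_sym: "u \<in> closed_nbhd G v \<longleftrightarrow> v \<in> closed_nbhd G u"
  using adj_sym by (auto simp: mem_closed_nbhd_iff)

lemma (in graph) closed_nbhd_subset_verts: "v \<in> verts G \<Longrightarrow> closed_nbhd G v \<subseteq> verts G"
  using adj_in_verts by (auto simp: closed_nbhd_def)

lemma (in graph) domination_le_packingI:
  assumes D: "D \<subseteq> verts G" "verts G \<subseteq> (\<Union>d\<in>D. closed_nbhd G d)"
    and P: "packing G P" and le: "card D \<le> c * card P"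
  shows "domination_number G \<le> c * packing_number G"
proof -
  have "dominating_set G D"
    using D closed_nbhd_subset_verts by (fastforce simp: dominating_set_def)
  moreover have "finite {card D | D. dominating_set G D}"
    by (rule finite_subset[of _ "card ` Pow (verts G)"]) (auto simp: dominating_set_def)
  ultimately have "domination_number G \<le> card D"
    unfolding domination_number_def by (intro Min_le) auto
  moreover have "finite {card P | P. packing G P}"
    by (rule finite_subset[of _ "card ` Pow (verts G)"]) (auto simp: packing_def)
  then have "card P \<le> packing_number G"
    unfolding packing_number_def using P by (intro Max_ge) auto
  ultimately show ?thesis
    using le by (meson le_trans mult_le_mono2)
qed

text \<open>
  The invariant \<open>Q\<close> restricts the sets of remaining vertices for which a round has to be possible.
\<close>

lemma (in graph) greedy_domination:
  assumes round: "\<And>U. \<lbrakk>U \<subseteq> verts G; U \<noteq> {}; Q U\<rbrakk> \<Longrightarrow>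
      \<exists>P D U'. P \<subseteq> U \<and> D \<subseteq> verts G \<and> card D \<le> c * card P \<and>
        disjoint_family_on (closed_nbhd G) P \<and> U' \<subset> U \<and> Q U' \<and>
        U - U' \<subseteq> (\<Union>d\<in>D. closed_nbhd G d) \<and>
        (\<forall>p\<in>P. \<forall>u\<in>U'. closed_nbhd G p \<inter> closed_nbhd G u = {})"
    and Q: "Q (verts G)"
  shows "domination_number G \<le> c * packing_number G"
proof -
  have "\<exists>P D. P \<subseteq> U \<and> D \<subseteq> verts G \<and> card D \<le> c * card P \<and>
      disjoint_family_on (closed_nbhd G) P \<and> U \<subseteq> (\<Union>d\<in>D. closed_nbhd G d)"
    if "U \<subseteq> verts G" "Q U" for U
  proof -
    have "finite U"
      by (rule finite_subset[OF that(1) finite_verts])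
    then show ?thesis using that
    proof (induction U rule: finite_psubset_induct)
      case (psubset U)
      show ?case
      proof (cases "U = {}")
        case True
        then show ?thesis
          by (intro exI[of _ "{}"]) (simp add: disjoint_family_on_def)
      next
        case False
        obtain P D U' where PD: "P \<subseteq> U" "D \<subseteq> verts G" "card D \<le> c * card P"
            "disjoint_family_on (closed_nbhd G) P" "U' \<subset> U" "Q U'"
            "U - U' \<subseteq> (\<Union>d\<in>D. closed_nbhd G d)"
            "\<forall>p\<in>P. \<forall>u\<in>U'. closed_nbhd G p \<inter> closed_nbhd G u = {}"
          using round[OF psubset.prems(1) False psubset.prems(2)] by metis
        obtain P' D' where PD': "P' \<subseteq> U'" "D' \<subseteq> verts G" "card D' \<le> c * card P'"
            "disjoint_family_on (closed_nbhd G) P'" "U' \<subseteq> (\<Union>d\<in>D'. closed_nbhd G d)"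
          using psubset.IH[OF PD(5) _ PD(6)] PD(5) psubset.prems(1) by blast
        have "P \<inter> P' = {}"
          using PD(8) PD'(1) by (fastforce simp: mem_closed_nbhd_iff)
        moreover have "finite P" "finite P'"
          using PD(1,5) PD'(1) psubset.hyps by (meson finite_subset psubset_imp_subset)+
        ultimately have "card (P \<union> P') = card P + card P'"
          by (simp add: card_Un_disjoint)
        then have "card (D \<union> D') \<le> c * card (P \<union> P')"
          using card_Un_le[of D D'] PD(3) PD'(3) by (simp add: distrib_left)
        moreover have "disjoint_family_on (closed_nbhd G) (P \<union> P')"
          using PD(4,8) PD'(1,4) unfolding disjoint_family_on_def
          by (metis Int_commute UnE subsetD)
        moreover have "U \<subseteq> (\<Union>d\<in>D \<union> D'. closed_nbhd G d)"
          using PD(7) PD'(5) by blast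
        ultimately show ?thesis
          using PD(1,2,5) PD'(1,2) by (intro exI[of _ "P \<union> P'"] exI[of _ "D \<union> D'"]) auto
      qed
    qed
  qed
  from this[OF subset_refl Q] show ?thesis
    by (metis domination_le_packingI packing_def)
qed

corollary (in graph) greedy_domination_single:
  assumes "\<And>U. \<lbrakk>U \<subseteq> verts G; U \<noteq> {}\<rbrakk> \<Longrightarrow> \<exists>v\<in>U. \<exists>D \<subseteq> verts G. card D \<le> c \<and>
      {u \<in> U. closed_nbhd G v \<inter> closed_nbhd G u \<noteq> {}} \<subseteq> (\<Union>d\<in>D. closed_nbhd G d)"
  shows "domination_number G \<le> c * packing_number G"
proof (rule greedy_domination[where Q = "\<lambda>_. True"])
  fix U assume "U \<subseteq> verts G" "U \<noteq> {}"
  then obtain v D where v: "v \<in> U" "D \<subseteq> verts G" "card D \<le> c"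
      "{u \<in> U. closed_nbhd G v \<inter> closed_nbhd G u \<noteq> {}} \<subseteq> (\<Union>d\<in>D. closed_nbhd G d)"
    using assms[of U] by blast
  let ?U' = "{u \<in> U. closed_nbhd G v \<inter> closed_nbhd G u = {}}"
  have "v \<notin> ?U'"
    by (auto simp: mem_closed_nbhd_iff)
  then have "?U' \<subset> U"
    using v(1) by blast
  moreover have "U - ?U' \<subseteq> (\<Union>d\<in>D. closed_nbhd G d)"
    using v(4) by blast
  moreover have "{v} \<subseteq> U" "card D \<le> c * card {v}" "disjoint_family_on (closed_nbhd G) {v}"
    using v(1,3) by (simp_all add: disjoint_family_on_def)
  moreover have "\<forall>p\<in>{v}. \<forall>u\<in>?U'. closed_nbhd G p \<inter> closed_nbhd G u = {}"
    by simp
  ultimately show "\<exists>P D U'. P \<subseteq> U \<and> D \<subseteq> verts G \<and> card D \<le> c * card P \<and>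
        disjoint_family_on (closed_nbhd G) P \<and> U' \<subset> U \<and> True \<and>
        U - U' \<subseteq> (\<Union>d\<in>D. closed_nbhd G d) \<and>
        (\<forall>p\<in>P. \<forall>u\<in>U'. closed_nbhd G p \<inter> closed_nbhd G u = {})"
    using v(2) by (intro exI[of _ "{v}"] exI[of _ D] exI[of _ ?U'] conjI TrueI)
qed simp

section \<open>Reachability inside a vertex set\<close>

text \<open>
  \<open>linked G W x y\<close>: the vertices \<open>x\<close> and \<open>y\<close> are joined by a walk of \<open>G\<close> all of whose vertices,
  including \<open>x\<close> and \<open>y\<close>, lie in \<open>W\<close>.
\<close>

inductive linked :: "('a, 'b) pre_digraph \<Rightarrow> 'a set \<Rightarrow> 'a \<Rightarrow> 'a \<Rightarrow> bool"
  for G W x where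
  refl: "x \<in> W \<Longrightarrow> linked G W x x"
| step: "linked G W x y \<Longrightarrow> y \<rightarrow>\<^bsub>G\<^esub> z \<Longrightarrow> z \<in> W \<Longrightarrow> linked G W x z"

lemma linked_start: "linked G W x y \<Longrightarrow> x \<in> W"
  by (induction rule: linked.induct)

lemma linked_end: "linked G W x y \<Longrightarrow> y \<in> W"
  by (induction rule: linked.induct)

lemma linked_trans:
  assumes "linked G W x y" "linked G W y z"
  shows "linked G W x z"
  using assms(2,1) by (induction rule: linked.induct) (auto intro: linked.step)

lemma (in graph) linked_sym: "linked G W x y \<Longrightarrow> linked G W y x"
proof (induction rule: linked.induct)
  case (step y z)
  have "linked G W z y"
    using step.hyps linked_end[OF step.hyps(1)] adj_sym by (meson linked.refl linked.step)
  then show ?case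
    using step.IH by (rule linked_trans)
qed (rule linked.refl)

text \<open>
  A walk in \<open>W\<close> only visits vertices that are reachable in \<open>W\<close>, so it lies in every set that contains
  all of these.
\<close>

lemma linked_into:
  assumes "linked G W x y" and "\<And>z. linked G W x z \<Longrightarrow> z \<in> W'"
  shows "linked G W' x y"
  using assms(1)
proof (induction rule: linked.induct)
  case refl
  then show ?case by (intro linked.refl assms(2) linked.refl)
next
  case (step y z)
  then show ?case by (meson assms(2) linked.step)
qed

lemma linked_mono: "linked G W x y \<Longrightarrow> W \<subseteq> W' \<Longrightarrow> linked G W' x y"
  by (meson linked_end linked_into subsetD)

lemma (in graph) linked_imp_joined_avoiding:
  assumes "linked G (verts G - S) u v"
  shows "joined_avoiding G S u v"
proof -
  have "\<exists>p. vwalk p G \<and> hd p = v \<and> last p = u \<and> set p \<inter> S = {}"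
    if "linked G (verts G - S) u v" for u v
    using that
  proof (induction rule: linked.induct)
    case refl
    then show ?case by (intro exI[of _ "[u]"]) auto
  next
    case (step y z)
    then obtain p where p: "vwalk p G" "hd p = y" "last p = u" "set p \<inter> S = {}"
      by blast
    have "vwalk (z # p) G"
      using p step.hyps adj_sym by (intro vwalk_consI) auto
    moreover have "p \<noteq> []"
      using p(1) by (auto simp: vwalk_def)
    ultimately show ?case
      using p step.hyps by (intro exI[of _ "z # p"]) auto
  qed
  from this[OF linked_sym[OF assms]] obtain p
    where "vwalk p G" "hd p = u" "last p = v" "set p \<inter> S = {}"
    by blast
  then show ?thesis
    unfolding joined_avoiding_def
    by (intro exI[of _ "vwalk_to_vpath p"])
      (auto simp: vwalk_to_vpath_hd vwalk_to_vpath_last vwalk_to_vpath_vpath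
        dest: vwalk_to_vpath_subset)
qed

section \<open>Dominating pairs in asteroidal triple-free graphs\<close>

text \<open>
  Mutual avoidance of neighbourhoods already forces the three vertices to be distinct and
  independent.
\<close>

lemma (in graph) asteroidal_tripleI:
  assumes "linked G (verts G - closed_nbhd G v) x u" "linked G (verts G - closed_nbhd G u) x v"
    "linked G (verts G - closed_nbhd G x) u v"
  shows "asteroidal_triple G {x, u, v}"
proof -
  have nbhd: "x \<notin> closed_nbhd G v" "u \<notin> closed_nbhd G v" "x \<notin> closed_nbhd G u"
      "v \<notin> closed_nbhd G u" "u \<notin> closed_nbhd G x" "v \<notin> closed_nbhd G x"
    and verts: "x \<in> verts G" "u \<in> verts G" "v \<in> verts G"
    using assms[THEN linked_start] assms[THEN linked_end] by auto
  have "card {x, u, v} = 3"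
    using nbhd by (auto simp: mem_closed_nbhd_iff)
  moreover have "independent_set G {x, u, v}"
    using nbhd verts adj_not_same by (auto simp: independent_set_def mem_closed_nbhd_iff)
  moreover have "joined_avoiding G (closed_nbhd G v) x u" "joined_avoiding G (closed_nbhd G v) u x"
      "joined_avoiding G (closed_nbhd G u) x v" "joined_avoiding G (closed_nbhd G u) v x"
      "joined_avoiding G (closed_nbhd G x) u v" "joined_avoiding G (closed_nbhd G x) v u"
    using assms linked_sym linked_imp_joined_avoiding by blast+
  ultimately show ?thesis
    unfolding asteroidal_triple_def by blast
qed

text \<open>
  The vertex \<open>x\<close> is pokable in the subgraph induced by \<open>W\<close>: no two vertices are unrelated relative
  to it, where \<open>u\<close> and \<open>v\<close> are unrelated relative to \<open>x\<close> if each of them can be reached from \<open>x\<close> by a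
  walk that avoids the closed neighbourhood of the other.
\<close>

definition pokable :: "('a, 'b) pre_digraph \<Rightarrow> 'a set \<Rightarrow> 'a \<Rightarrow> bool" where
  "pokable G W x \<longleftrightarrow>
     (\<forall>u v. \<not> (linked G (W - closed_nbhd G v) x u \<and> linked G (W - closed_nbhd G u) x v))"

text \<open>
  Fix \<open>a\<close> and choose \<open>x\<close> such that the component \<open>A\<close> of \<open>a\<close> in \<open>W - N[x]\<close> is as large as possible.
  Let \<open>R\<close> be the set of vertices without closed neighbours in \<open>A\<close>. By maximality, every vertex of
  \<open>R\<close> yields the same component \<open>A\<close> and is therefore adjacent to every neighbour of \<open>A\<close> outside \<open>A\<close>.
  Hence walks that start in \<open>R\<close> and avoid the neighbourhood of a vertex of \<open>R\<close> stay in \<open>R\<close>,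
  and for a vertex \<open>y\<close> that is pokable in \<open>R\<close>, which exists by induction, no two vertices \<open>u, v\<close> of \<open>R\<close>
  are unrelated relative to \<open>y\<close> in \<open>W\<close>. If both \<open>u\<close> and \<open>v\<close> were in \<open>A\<close>, then \<open>{y, u, v}\<close> would be an
  asteroidal triple; if only \<open>v\<close> were in \<open>A\<close>, then \<open>y\<close> would belong to the component of \<open>a\<close> in
  \<open>W - N[u]\<close>, which is \<open>A\<close>. Hence \<open>y\<close> is pokable in \<open>W\<close>.
\<close>

lemma (in graph) ex_pokable:
  assumes atf: "asteroidal_triple_free G" and "W \<subseteq> verts G" "W \<noteq> {}"
  shows "\<exists>x\<in>W. pokable G W x"
proof -
  have "finite W"
    by (rule finite_subset[OF assms(2) finite_verts])
  then show ?thesis using assms(2,3)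
  proof (induction W rule: finite_psubset_induct)
    case (psubset W)
    define C where "C a z = {t. linked G (W - closed_nbhd G z) a t}" for a z
    obtain a where a: "a \<in> W"
      using psubset.prems by blast
    have C_sub: "C a z \<subseteq> W - closed_nbhd G z" for z
      by (auto simp: C_def dest: linked_end)
    have fin_C: "finite (C a z)" for z
      using C_sub psubset.hyps by (meson Diff_subset finite_subset)
    obtain x where x: "x \<in> W" and x_max: "\<And>z. z \<in> W \<Longrightarrow> card (C a z) \<le> card (C a x)"
      using obtains_MAX[of W "\<lambda>z. card (C a z)"] psubset.hyps a
      by (metis Max_ge empty_iff finite_imageI image_eqI)
    define A where "A = C a x"
    show ?case
    proof (cases "A = {}")
      case True
      \<comment> \<open>By maximality, \<open>a\<close> is then adjacent to all other vertices of \<open>W\<close>.\<close>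
      have "a \<in> closed_nbhd G z" if "z \<in> W" for z
      proof (rule ccontr)
        assume "a \<notin> closed_nbhd G z"
        then have "a \<in> C a z"
          using a by (auto simp: C_def intro: linked.refl)
        then have "card (C a z) > 0"
          using fin_C card_gt_0_iff by blast
        then show False
          using x_max[OF that] True by (simp add: A_def)
      qed
      then have "pokable G W a"
        unfolding pokable_def by (metis DiffD1 DiffD2 linked_end linked_start)
      with a show ?thesis by blast
    next
      case False
      then have aA: "a \<in> A"
        by (auto simp: A_def C_def intro: linked.refl dest: linked_start)
      define R where "R = {z \<in> W. closed_nbhd G z \<inter> A = {}}"
      have C_eq: "C a z = A" if "z \<in> R" for z
      proof -
        have "A \<subseteq> C a z"
        proof
          fix t assume "t \<in> A"
          moreover have "A \<subseteq> W - closed_nbhd G z"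
            using that C_sub[of x] by (auto simp: R_def A_def)
          ultimately show "t \<in> C a z"
            unfolding A_def C_def by (auto intro: linked_into)
        qed
        moreover have "card (C a z) \<le> card A"
          using that x_max by (simp add: R_def A_def)
        ultimately show ?thesis
          using fin_C card_seteq by metis
      qed
      have mem_R: "s \<in> R"
        if z: "z \<in> W" "C a z = A" and s: "s \<in> W" "s \<notin> closed_nbhd G z" "s \<notin> A" for z s
      proof -
        have False if t: "t \<in> closed_nbhd G s" "t \<in> A" for t
        proof -
          have "t \<rightarrow>\<^bsub>G\<^esub> s"
            using t s(3) adj_sym by (auto simp: mem_closed_nbhd_iff)
          then have "s \<in> C a z"
            using t(2) z(2) s(1,2) by (auto simp: C_def intro: linked.step)
          then show False
            using z(2) s(3) by simp
        qed
        then show ?thesis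
          using s(1) by (auto simp: R_def)
      qed
      have "x \<in> R"
        using x C_sub[of x] by (auto intro!: mem_R[of x] simp: A_def R_def)
      have "a \<notin> R"
        using aA by (auto simp: R_def mem_closed_nbhd_iff)
      then have "R \<subset> W"
        using a by (auto simp: R_def)
      then obtain y where y: "y \<in> R" and y_pok: "pokable G R y"
        using psubset.IH[of R] psubset.prems(1) \<open>x \<in> R\<close> by blast
      have yW: "y \<in> W" and yA: "y \<notin> A"
        using y by (auto simp: R_def mem_closed_nbhd_iff)
      have "\<not> (linked G (W - closed_nbhd G v) y u \<and> linked G (W - closed_nbhd G u) y v)" for u v
      proof
        assume "linked G (W - closed_nbhd G v) y u \<and> linked G (W - closed_nbhd G u) y v"
        then have yu: "linked G (W - closed_nbhd G v) y u"
          and yv: "linked G (W - closed_nbhd G u) y v" by auto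
        have uW: "u \<in> W" "u \<notin> closed_nbhd G y" and vW: "v \<in> W" "v \<notin> closed_nbhd G y"
          using linked_start[OF yu] linked_end[OF yu] linked_start[OF yv] linked_end[OF yv]
          by (auto simp: closed_nbhd_sym)
        have not_mixed: False
          if "p \<in> R" "q \<in> A" "linked G (W - closed_nbhd G p) y q" for p q
        proof -
          have "linked G (W - closed_nbhd G p) a q"
            using that(2) C_eq[OF that(1)] by (auto simp: C_def)
          then have "y \<in> C a p"
            unfolding C_def using that(3) by (blast intro: linked_trans linked_sym)
          then show False
            using C_eq[OF that(1)] yA by simp
        qed
        have stay: "linked G (R - closed_nbhd G p) y q"
          if "p \<in> R" "linked G (W - closed_nbhd G p) y q" for p q
        proof (rule linked_into[OF that(2)])
          fix s assume s: "linked G (W - closed_nbhd G p) y s"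
          have "s \<in> W - closed_nbhd G p"
            using s by (rule linked_end)
          moreover have "s \<notin> A"
            using not_mixed[OF that(1) _ s] by blast
          ultimately show "s \<in> R - closed_nbhd G p"
            using mem_R[of p s] C_eq[OF that(1)] that(1) by (auto simp: R_def)
        qed
        consider "u \<in> A" "v \<in> A" | "u \<in> R" "v \<in> A" | "u \<in> A" "v \<in> R" | "u \<in> R" "v \<in> R"
          using mem_R[OF yW C_eq[OF y]] uW vW by blast
        then show False
        proof cases
          case 1
          then have "linked G (W - closed_nbhd G y) u v"
            using C_eq[OF y] unfolding C_def by (blast intro: linked_trans linked_sym)
          then have "asteroidal_triple G {y, u, v}"
            using yu yv psubset.prems(1)
            by (intro asteroidal_tripleI) (auto elim!: linked_mono)
          then show False
            using atf by (auto simp: asteroidal_triple_free_def)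
        next
          case 2
          then show False using not_mixed yv by blast
        next
          case 3
          then show False using not_mixed yu by blast
        next
          case 4
          then show False
            using stay[OF _ yu] stay[OF _ yv] y_pok by (auto simp: pokable_def)
        qed
      qed
      then show ?thesis
        using yW unfolding pokable_def by blast
    qed
  qed
qed

text \<open>
  A second end \<open>y\<close> of a dominating pair is obtained by maximising the component of \<open>x\<close> in
  \<open>W - N[y]\<close>: if \<open>x\<close> and \<open>y\<close> were joined in \<open>W - N[v]\<close>, then the component of \<open>x\<close> in \<open>W - N[v]\<close>
  would be larger, since it would contain \<open>y\<close> as well.
\<close>

lemma (in graph) pokable_imp_dominating_pair:
  assumes "finite W" "x \<in> W" "pokable G W x"
  shows "\<exists>y\<in>W. \<forall>v\<in>W. \<not> linked G (W - closed_nbhd G v) x y"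
proof -
  define C where "C v = {t. linked G (W - closed_nbhd G v) x t}" for v
  have fin_C: "finite (C v)" for v
    by (rule finite_subset[OF _ assms(1)]) (auto simp: C_def dest: linked_end)
  obtain y where y: "y \<in> W" and y_max: "\<And>z. z \<in> W \<Longrightarrow> card (C z) \<le> card (C y)"
    using obtains_MAX[of W "\<lambda>z. card (C z)"] assms
    by (metis Max_ge empty_iff finite_imageI image_eqI)
  have False if v: "v \<in> W" and xy: "linked G (W - closed_nbhd G v) x y" for v
  proof -
    have vC: "v \<notin> C y"
      using assms(3) xy by (auto simp: pokable_def C_def)
    have yv: "y \<notin> closed_nbhd G v"
      using linked_end[OF xy] by simp
    have "C y \<subseteq> C v"
    proof
      fix t assume t: "t \<in> C y"
      have "s \<in> W - closed_nbhd G v" if s: "linked G (W - closed_nbhd G y) x s" for s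
      proof -
        have "s \<notin> closed_nbhd G v"
        proof
          assume sv: "s \<in> closed_nbhd G v"
          have "s \<noteq> v"
            using s vC by (auto simp: C_def)
          then have "s \<rightarrow>\<^bsub>G\<^esub> v"
            using sv adj_sym by (auto simp: mem_closed_nbhd_iff)
          moreover have "v \<in> W - closed_nbhd G y"
            using v yv closed_nbhd_sym by blast
          ultimately have "v \<in> C y"
            using s by (auto simp: C_def intro: linked.step)
          with vC show False ..
        qed
        then show ?thesis
          using linked_end[OF s] by simp
      qed
      then show "t \<in> C v"
        using t by (auto simp: C_def intro: linked_into)
    qed
    moreover have "y \<in> C v" "y \<notin> C y"
      using xy by (auto simp: C_def mem_closed_nbhd_iff dest: linked_end)
    ultimately have "card (C y) < card (C v)"
      using fin_C by (intro psubset_card_mono) auto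
    then show False
      using y_max[OF v] by simp
  qed
  with y show ?thesis by blast
qed

section \<open>Asteroidal triple-free graphs\<close>

text \<open>
  If the neighbourhoods met, then at most two edges would lead from \<open>f i\<close> to \<open>f j\<close>, and the path
  could be shortened.
\<close>

lemma (in graph) geodesic_disjoint_nbhds:
  assumes f: "\<And>i. i < n \<Longrightarrow> f i \<rightarrow>\<^bsub>G\<^esub> f (Suc i)"
    and least: "\<And>m. ((\<lambda>u v. u \<rightarrow>\<^bsub>G\<^esub> v) ^^ m) (f 0) (f n) \<Longrightarrow> n \<le> m"
    and ij: "i + 3 \<le> j" "j \<le> n"
  shows "closed_nbhd G (f i) \<inter> closed_nbhd G (f j) = {}"
proof (rule ccontr)
  let ?E = "\<lambda>u v. u \<rightarrow>\<^bsub>G\<^esub> v"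
  assume "closed_nbhd G (f i) \<inter> closed_nbhd G (f j) \<noteq> {}"
  then obtain z where z: "z \<in> closed_nbhd G (f i)" "f j \<in> closed_nbhd G z"
    using closed_nbhd_sym by blast
  have near: "\<exists>k\<le>1. (?E ^^ k) u v" if "v \<in> closed_nbhd G u" for u v
  proof (cases "v = u")
    case True
    then show ?thesis by (intro exI[of _ 0]) simp
  next
    case False
    then have "?E u v"
      using that by (simp add: mem_closed_nbhd_iff)
    then have "(?E ^^ 1) u v"
      unfolding relpowp_1 .
    then show ?thesis by blast
  qed
  have seg: "(?E ^^ k) (f p) (f (p + k))" if "p + k \<le> n" for p k
    using that
  proof (induction k)
    case (Suc k)
    then show ?case
      using f[of "p + k"] by (auto intro: relpowp_Suc_I)
  qed simp
  obtain k l where "k \<le> 1" "(?E ^^ k) (f i) z" "l \<le> 1" "(?E ^^ l) z (f j)"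
    using near[OF z(1)] near[OF z(2)] by blast
  moreover have "(?E ^^ i) (f 0) (f i)" "(?E ^^ (n - j)) (f j) (f n)"
    using seg[of 0 i] seg[of j "n - j"] ij by auto
  ultimately have "(?E ^^ (i + k + l + (n - j))) (f 0) (f n)"
    by (blast intro: relpowp_trans)
  then show False
    using least[of "i + k + l + (n - j)"] ij \<open>k \<le> 1\<close> \<open>l \<le> 1\<close> by linarith
qed

text \<open>The hypotheses say that \<open>K\<close> is a connected component.\<close>

lemma (in graph) component_domination:
  assumes atf: "asteroidal_triple_free G" and K: "K \<subseteq> verts G" "K \<noteq> {}"
    and closed: "\<And>u v. u \<in> K \<Longrightarrow> u \<rightarrow>\<^bsub>G\<^esub> v \<Longrightarrow> v \<in> K"
    and conn: "\<And>u v. u \<in> K \<Longrightarrow> v \<in> K \<Longrightarrow> linked G K u v"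
  shows "\<exists>P D. P \<subseteq> K \<and> P \<noteq> {} \<and> D \<subseteq> K \<and> card D \<le> 3 * card P \<and>
    disjoint_family_on (closed_nbhd G) P \<and> K \<subseteq> (\<Union>d\<in>D. closed_nbhd G d)"
proof -
  let ?E = "\<lambda>u v. u \<rightarrow>\<^bsub>G\<^esub> v"
  obtain x where x: "x \<in> K" "pokable G K x"
    using ex_pokable[OF atf K] by blast
  obtain y where y: "y \<in> K" and dom: "\<And>v. v \<in> K \<Longrightarrow> \<not> linked G (K - closed_nbhd G v) x y"
    using pokable_imp_dominating_pair[OF finite_subset[OF K(1) finite_verts] x] by blast
  have "\<exists>n. (?E ^^ n) x z" if "linked G K x z" for z
    using that
  proof (induction rule: linked.induct)
    case refl
    show ?case by (intro exI[of _ 0]) simp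
  next
    case (step y z)
    then show ?case by (blast intro: relpowp_Suc_I)
  qed
  then have ex: "\<exists>n. (?E ^^ n) x y"
    using conn[OF x(1) y] by blast
  define n where "n = (LEAST n. (?E ^^ n) x y)"
  have "(?E ^^ n) x y" and least: "\<And>m. (?E ^^ m) x y \<Longrightarrow> n \<le> m"
    using LeastI_ex[OF ex] by (auto simp: n_def intro: Least_le)
  then obtain f where f: "f 0 = x" "f n = y" "\<And>i. i < n \<Longrightarrow> f i \<rightarrow>\<^bsub>G\<^esub> f (Suc i)"
    unfolding relpowp_fun_conv by blast
  have fK: "f i \<in> K" if "i \<le> n" for i
    using that by (induction i) (use f x closed in auto)
  define D where "D = f ` {..n}"
  define P where "P = (\<lambda>k. f (3 * k)) ` {..n div 3}"
  have apart: "closed_nbhd G (f (3 * k)) \<inter> closed_nbhd G (f (3 * l)) = {}"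
    if "k < l" "l \<le> n div 3" for k l
    by (rule geodesic_disjoint_nbhds[of n]) (use that f least in auto)
  have apart': "closed_nbhd G (f (3 * k)) \<inter> closed_nbhd G (f (3 * l)) = {}"
    if "k \<noteq> l" "l \<le> n div 3" "k \<le> n div 3" for k l
    using apart[of k l] apart[of l k] that by (cases "k < l") auto
  have "inj_on (\<lambda>k. f (3 * k)) {..n div 3}"
  proof (rule inj_onI, rule ccontr)
    fix k l assume "k \<in> {..n div 3}" "l \<in> {..n div 3}" "f (3 * k) = f (3 * l)" "k \<noteq> l"
    then show False
      using apart'[of k l] by (auto simp: mem_closed_nbhd_iff)
  qed
  then have "card P = n div 3 + 1"
    by (simp add: P_def card_image)
  moreover have "card D \<le> n + 1"
    using card_image_le[of "{..n}" f] by (simp add: D_def)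
  ultimately have "card D \<le> 3 * card P"
    by linarith
  moreover have "disjoint_family_on (closed_nbhd G) P"
    unfolding disjoint_family_on_def
  proof (intro ballI impI)
    fix p q assume "p \<in> P" "q \<in> P" "p \<noteq> q"
    then obtain k l where kl: "p = f (3 * k)" "q = f (3 * l)" "k \<le> n div 3" "l \<le> n div 3" "k \<noteq> l"
      by (auto simp: P_def)
    then show "closed_nbhd G p \<inter> closed_nbhd G q = {}"
      using apart'[OF kl(5,4,3)] by simp
  qed
  moreover have "K \<subseteq> (\<Union>d\<in>D. closed_nbhd G d)"
  proof (rule subsetI, rule ccontr)
    fix v assume v: "v \<in> K" "v \<notin> (\<Union>d\<in>D. closed_nbhd G d)"
    then have avoid: "f i \<in> K - closed_nbhd G v" if "i \<le> n" for i
      using that fK closed_nbhd_sym by (auto simp: D_def)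
    have "linked G (K - closed_nbhd G v) x (f i)" if "i \<le> n" for i
      using that
    proof (induction i)
      case 0
      then show ?case using avoid[of 0] f(1) by (auto intro: linked.refl)
    next
      case (Suc i)
      then show ?case using avoid[of "Suc i"] f(3)[of i] by (auto intro: linked.step)
    qed
    then show False
      using dom[OF v(1)] f(2) by blast
  qed
  moreover have "P \<subseteq> K" "P \<noteq> {}" "D \<subseteq> K"
    using fK by (auto simp: P_def D_def)
  ultimately show ?thesis by blast
qed

theorem (in graph) asteroidal_triple_free_domination:
  assumes "asteroidal_triple_free G"
  shows "domination_number G \<le> 3 * packing_number G"
proof (rule greedy_domination[where Q = "\<lambda>U. \<forall>u\<in>U. \<forall>v. u \<rightarrow>\<^bsub>G\<^esub> v \<longrightarrow> v \<in> U"])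
  fix U assume U: "U \<subseteq> verts G" "U \<noteq> {}" "\<forall>u\<in>U. \<forall>v. u \<rightarrow>\<^bsub>G\<^esub> v \<longrightarrow> v \<in> U"
  then obtain a where a: "a \<in> U" by blast
  define K where "K = {z. linked G (verts G) a z}"
  have aK: "a \<in> K"
    using a U by (auto simp: K_def intro: linked.refl)
  have "z \<in> U" if "linked G (verts G) a z" for z
    using that by (induction rule: linked.induct) (use a U in auto)
  then have KU: "K \<subseteq> U"
    by (auto simp: K_def)
  have closed: "v \<in> K" if "u \<in> K" "u \<rightarrow>\<^bsub>G\<^esub> v" for u v
    using that adj_in_verts by (auto simp: K_def intro: linked.step)
  have conn: "linked G K u v" if "u \<in> K" "v \<in> K" for u v
  proof -
    have "linked G K a z" if "z \<in> K" for z
      using that unfolding K_def by (auto intro: linked_into)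
    then show ?thesis
      using that by (blast intro: linked_trans linked_sym)
  qed
  have "K \<noteq> {}"
    using aK by blast
  have "\<exists>P D. P \<subseteq> K \<and> P \<noteq> {} \<and> D \<subseteq> K \<and> card D \<le> 3 * card P \<and>
    disjoint_family_on (closed_nbhd G) P \<and> K \<subseteq> (\<Union>d\<in>D. closed_nbhd G d)"
    by (rule component_domination[OF assms subset_trans[OF KU U(1)] \<open>K \<noteq> {}\<close>])
      (auto intro: closed conn)
  then obtain P D where PD: "P \<subseteq> K" "P \<noteq> {}" "D \<subseteq> K" "card D \<le> 3 * card P"
      "disjoint_family_on (closed_nbhd G) P" "K \<subseteq> (\<Union>d\<in>D. closed_nbhd G d)"
    by metis
  have "u \<in> K" if "p \<in> K" "z \<in> closed_nbhd G p" "z \<in> closed_nbhd G u" for p z u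
    using that closed adj_sym by (metis mem_closed_nbhd_iff)
  then have "\<forall>p\<in>P. \<forall>u\<in>U - K. closed_nbhd G p \<inter> closed_nbhd G u = {}"
    using PD(1) by blast
  moreover have "\<forall>u\<in>U - K. \<forall>v. u \<rightarrow>\<^bsub>G\<^esub> v \<longrightarrow> v \<in> U - K"
    using U(3) closed adj_sym by blast
  moreover have "U - K \<subset> U" "U - (U - K) \<subseteq> (\<Union>d\<in>D. closed_nbhd G d)"
    using a aK PD(6) by blast+
  moreover have "P \<subseteq> U" "D \<subseteq> verts G"
    using PD(1,3) KU U(1) by blast+
  ultimately show "\<exists>P D U'. P \<subseteq> U \<and> D \<subseteq> verts G \<and> card D \<le> 3 * card P \<and>
      disjoint_family_on (closed_nbhd G) P \<and> U' \<subset> U \<and>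
      (\<forall>u\<in>U'. \<forall>v. u \<rightarrow>\<^bsub>G\<^esub> v \<longrightarrow> v \<in> U') \<and> U - U' \<subseteq> (\<Union>d\<in>D. closed_nbhd G d) \<and>
      (\<forall>p\<in>P. \<forall>u\<in>U'. closed_nbhd G p \<inter> closed_nbhd G u = {})"
    using PD(4,5) by (intro exI[of _ P] exI[of _ D] exI[of _ "U - K"] conjI)
qed (use adj_in_verts in auto)

section \<open>Convex graphs\<close>

lemma linear_order_on_finite_ex_rank:
  assumes "finite X" "linear_order_on X r"
  shows "\<exists>f :: 'a \<Rightarrow> nat. \<forall>a\<in>X. \<forall>b\<in>X. (a, b) \<in> r \<longleftrightarrow> f a \<le> f b"
proof -
  define f where "f a = card {b \<in> X. (b, a) \<in> r}" for a
  have r: "trans r" "antisym r" "total_on X r" "\<And>a. a \<in> X \<Longrightarrow> (a, a) \<in> r"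
    using assms(2)
    by (auto simp: linear_order_on_def partial_order_on_def preorder_on_def refl_on_def)
  have mono: "f a \<le> f b" if "(a, b) \<in> r" for a b
    unfolding f_def using that r(1) assms(1) by (intro card_mono) (auto dest: transD)
  have strict: "f b < f a" if "(a, b) \<notin> r" "a \<in> X" "b \<in> X" for a b
  proof -
    have ba: "(b, a) \<in> r"
      using r(3,4) that by (metis total_on_def)
    have "{c \<in> X. (c, b) \<in> r} \<subset> {c \<in> X. (c, a) \<in> r}"
      using ba that r(1,4) by (auto dest: transD)
    then show ?thesis
      unfolding f_def using assms(1) by (intro psubset_card_mono) auto
  qed
  show ?thesis
    using mono strict by (intro exI[of _ f]) (meson not_le)
qed

theorem (in graph) convex_graph_domination:
  assumes "convex_graph G"
  shows "domination_number G \<le> 2 * packing_number G"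
proof -
  obtain X Y r where bip: "bipartition G X Y" and lin: "linear_order_on X r"
    and cons: "\<forall>y\<in>Y. consecutive_in r X {x \<in> X. y \<rightarrow>\<^bsub>G\<^esub> x}"
    using assms unfolding convex_graph_def by blast
  have XY: "X \<union> Y = verts G" "X \<inter> Y = {}"
    and adj_X: "\<And>u v. u \<rightarrow>\<^bsub>G\<^esub> v \<Longrightarrow> u \<in> X \<Longrightarrow> v \<in> Y"
    and adj_Y: "\<And>u v. u \<rightarrow>\<^bsub>G\<^esub> v \<Longrightarrow> u \<in> Y \<Longrightarrow> v \<in> X"
    using bip adj_in_verts unfolding bipartition_def independent_set_def by blast+
  have "finite X"
    using XY(1) by (metis finite_Un finite_verts)
  then obtain f :: "'a \<Rightarrow> nat" where f: "\<And>a b. a \<in> X \<Longrightarrow> b \<in> X \<Longrightarrow> (a, b) \<in> r \<longleftrightarrow> f a \<le> f b"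
    using linear_order_on_finite_ex_rank[OF _ lin] by blast
  have between: "y \<rightarrow>\<^bsub>G\<^esub> b"
    if "y \<in> Y" "y \<rightarrow>\<^bsub>G\<^esub> a" "y \<rightarrow>\<^bsub>G\<^esub> c" "b \<in> X" "f a \<le> f b" "f b \<le> f c" for y a b c
  proof -
    have "a \<in> X" "c \<in> X"
      using that adj_Y by blast+
    then show ?thesis
      using that cons f unfolding consecutive_in_def by blast
  qed
  define N where "N y = {x. y \<rightarrow>\<^bsub>G\<^esub> x}" for y
  have fin_N: "finite (N y)" for y
    by (rule finite_subset[OF _ finite_verts]) (auto simp: N_def adj_in_verts)
  \<comment> \<open>The rank of \<open>v\<close> itself or of its rightmost neighbour. For \<open>v \<in> Y\<close> without neighbours the maximum
      is unspecified; such \<open>v\<close> are treated separately.\<close>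
  define key where "key v = (if v \<in> X then f v else Max (f ` N v))" for v
  have key_ge: "f x \<le> key y" if "y \<in> Y" "y \<rightarrow>\<^bsub>G\<^esub> x" for x y
    using that XY(2) fin_N by (auto simp: key_def N_def)
  have key_att: "\<exists>m. y \<rightarrow>\<^bsub>G\<^esub> m \<and> f m = key y" if "y \<in> Y" "N y \<noteq> {}" for y
  proof -
    have "Max (f ` N y) \<in> f ` N y"
      using that fin_N by (intro Max_in) auto
    then show ?thesis
      using that XY(2) by (auto simp: key_def N_def)
  qed
  show ?thesis
  proof (rule greedy_domination_single)
    fix U assume U: "U \<subseteq> verts G" "U \<noteq> {}"
    show "\<exists>v\<in>U. \<exists>D \<subseteq> verts G. card D \<le> 2 \<and>
      {u \<in> U. closed_nbhd G v \<inter> closed_nbhd G u \<noteq> {}} \<subseteq> (\<Union>d\<in>D. closed_nbhd G d)"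
    proof (cases "\<exists>v\<in>U. N v = {}")
      case True
      then obtain v where v: "v \<in> U" "N v = {}" by blast
      have isolated: "\<not> v \<rightarrow>\<^bsub>G\<^esub> z" "\<not> z \<rightarrow>\<^bsub>G\<^esub> v" for z
        using v(2) adj_sym[of z v] by (auto simp: N_def)
      have "u = v" if "closed_nbhd G v \<inter> closed_nbhd G u \<noteq> {}" for u
        using that by (auto simp: mem_closed_nbhd_iff isolated)
      then have "{u \<in> U. closed_nbhd G v \<inter> closed_nbhd G u \<noteq> {}} \<subseteq> {v}"
        by blast
      moreover have "{v} \<subseteq> (\<Union>d\<in>{v}. closed_nbhd G d)"
        by (simp add: mem_closed_nbhd_iff)
      ultimately have "{u \<in> U. closed_nbhd G v \<inter> closed_nbhd G u \<noteq> {}} \<subseteq>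
          (\<Union>d\<in>{v}. closed_nbhd G d)"
        by (rule subset_trans)
      moreover have "{v} \<subseteq> verts G" "card {v} \<le> 2"
        using v(1) U(1) by auto
      ultimately show ?thesis
        using v(1) by blast
    next
      case False
      have "finite U"
        by (rule finite_subset[OF U(1) finite_verts])
      then obtain v where v: "v \<in> U" and v_min: "\<And>u. u \<in> U \<Longrightarrow> key v \<le> key u"
        using ex_min_if_finite[of "key ` U"] U(2) by (auto simp: not_less)
      have Nv: "N v \<noteq> {}"
        using False v by blast
      have "\<exists>w. v \<rightarrow>\<^bsub>G\<^esub> w \<and> (\<forall>u\<in>U. \<forall>z. v \<rightarrow>\<^bsub>G\<^esub> z \<and> z \<rightarrow>\<^bsub>G\<^esub> u \<longrightarrow> w \<rightarrow>\<^bsub>G\<^esub> u)"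
      proof (cases "v \<in> X")
        case True
        \<comment> \<open>Among the intervals that contain \<open>v\<close>, the one that reaches farthest dominates.\<close>
        have "finite (key ` N v)" "key ` N v \<noteq> {}"
          using fin_N Nv by auto
        then have "Max (key ` N v) \<in> key ` N v"
          by (rule Max_in)
        then obtain w where w: "v \<rightarrow>\<^bsub>G\<^esub> w" "key w = Max (key ` N v)"
          by (auto simp: N_def)
        have w_max: "key z \<le> key w" if "v \<rightarrow>\<^bsub>G\<^esub> z" for z
          using that fin_N w(2) by (auto simp: N_def)
        have wY: "w \<in> Y" and wv: "w \<rightarrow>\<^bsub>G\<^esub> v"
          using w(1) True adj_X adj_sym by blast+
        then obtain m where m: "w \<rightarrow>\<^bsub>G\<^esub> m" "f m = key w"
          using key_att[of w] by (auto simp: N_def)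
        have "w \<rightarrow>\<^bsub>G\<^esub> u" if "u \<in> U" "v \<rightarrow>\<^bsub>G\<^esub> z" "z \<rightarrow>\<^bsub>G\<^esub> u" for u z
        proof -
          have z: "z \<in> Y"
            using that True adj_X by blast
          then have u: "u \<in> X"
            using that adj_Y by blast
          have "f v \<le> f u"
            using v_min[OF that(1)] True u by (simp add: key_def)
          moreover have "f u \<le> f m"
            using key_ge[OF z that(3)] w_max[OF that(2)] m(2) by simp
          ultimately show ?thesis
            using between[OF wY wv m(1) u] by blast
        qed
        with w(1) show ?thesis by blast
      next
        case False
        \<comment> \<open>The rightmost neighbour \<open>w\<close> of \<open>v\<close> lies in every interval of \<open>U\<close> that meets the one of \<open>v\<close>,
            because none of these ends before \<open>w\<close>.\<close>
        then have vY: "v \<in> Y"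
          using v U(1) XY(1) by blast
        then obtain w where w: "v \<rightarrow>\<^bsub>G\<^esub> w" "f w = key v"
          using key_att Nv by blast
        have "w \<rightarrow>\<^bsub>G\<^esub> u" if "u \<in> U" "v \<rightarrow>\<^bsub>G\<^esub> z" "z \<rightarrow>\<^bsub>G\<^esub> u" for u z
        proof -
          have u: "u \<in> Y" and uz: "u \<rightarrow>\<^bsub>G\<^esub> z"
            using that vY adj_X adj_Y adj_sym by blast+
          obtain m where m: "u \<rightarrow>\<^bsub>G\<^esub> m" "f m = key u"
            using key_att[OF u] uz by (auto simp: N_def)
          have "f z \<le> f w"
            using key_ge[OF vY that(2)] w(2) by simp
          moreover have "f w \<le> f m"
            using v_min[OF that(1)] w(2) m(2) by simp
          moreover have "w \<in> X"
            using w(1) vY adj_Y by blast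
          ultimately show ?thesis
            using between[OF u uz m(1)] adj_sym by blast
        qed
        with w(1) show ?thesis by blast
      qed
      then obtain w where w: "v \<rightarrow>\<^bsub>G\<^esub> w"
          and w_dom: "\<And>u z. u \<in> U \<Longrightarrow> v \<rightarrow>\<^bsub>G\<^esub> z \<Longrightarrow> z \<rightarrow>\<^bsub>G\<^esub> u \<Longrightarrow> w \<rightarrow>\<^bsub>G\<^esub> u"
        by blast
      have "u \<in> closed_nbhd G v \<union> closed_nbhd G w"
        if u: "u \<in> U" "closed_nbhd G v \<inter> closed_nbhd G u \<noteq> {}" for u
      proof -
        obtain z where "z \<in> closed_nbhd G v" "u \<in> closed_nbhd G z"
          using u(2) closed_nbhd_sym by blast
        then show ?thesis
          using w_dom[OF u(1)] by (auto simp: mem_closed_nbhd_iff)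
      qed
      moreover have "card {v, w} \<le> 2"
        by (simp add: card_insert_if)
      moreover have "{v, w} \<subseteq> verts G"
        using v U(1) w adj_in_verts by blast
      ultimately show ?thesis
        using v by (intro bexI[of _ v] exI[of _ "{v, w}"]) auto
    qed
  qed
qed

section \<open>Unit-disk graphs\<close>

lemma cball_Int_cball_nonempty_iff:
  fixes a b :: "'a :: real_normed_vector"
  assumes "0 \<le> r"
  shows "cball a r \<inter> cball b r \<noteq> {} \<longleftrightarrow> dist a b \<le> 2 * r"
proof
  assume "cball a r \<inter> cball b r \<noteq> {}"
  then obtain z where "dist a z \<le> r" "dist b z \<le> r" by auto
  then show "dist a b \<le> 2 * r"
    using dist_triangle2[of a b z] by linarith
next
  assume "dist a b \<le> 2 * r"
  then have "midpoint a b \<in> cball a r \<inter> cball b r"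
    by (simp add: dist_midpoint)
  then show "cball a r \<inter> cball b r \<noteq> {}" by blast
qed

text \<open>
  The side length \<open>7/5\<close> of a cell is greater than \<open>4/3\<close>, so that three half-open cells cover a closed
  interval of length \<open>4\<close>, and at most \<open>sqrt 2\<close>, so that two points in one cell have distance at most \<open>2\<close>.
\<close>

theorem (in graph) unit_disk_graph_domination:
  assumes "unit_disk_graph G"
  shows "domination_number G \<le> 18 * packing_number G"
proof -
  obtain c :: "'a \<Rightarrow> real ^ 2" where "\<And>u v. u \<in> verts G \<Longrightarrow> v \<in> verts G \<Longrightarrow>
      u \<rightarrow>\<^bsub>G\<^esub> v \<longleftrightarrow> u \<noteq> v \<and> cball (c u) 1 \<inter> cball (c v) 1 \<noteq> {}"
    using assms unfolding unit_disk_graph_def by metis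
  then have nbhd: "u \<in> closed_nbhd G v \<longleftrightarrow> dist (c u) (c v) \<le> 2"
    if "u \<in> verts G" "v \<in> verts G" for u v
    using that by (auto simp: mem_closed_nbhd_iff cball_Int_cball_nonempty_iff dist_commute)
  show ?thesis
  proof (rule greedy_domination_single)
    fix U assume U: "U \<subseteq> verts G" "U \<noteq> {}"
    have "finite U"
      by (rule finite_subset[OF U(1) finite_verts])
    then obtain v where v: "v \<in> U" and v_min: "\<And>u. u \<in> U \<Longrightarrow> c v $ 1 \<le> c u $ 1"
      using ex_min_if_finite[of "(\<lambda>u. c u $ 1) ` U"] U(2) by (auto simp: not_less)
    define B where "B = {u \<in> U. closed_nbhd G v \<inter> closed_nbhd G u \<noteq> {}}"
    define cell where
      "cell u = (\<lfloor>(c u $ 1 - c v $ 1) / (7 / 5)\<rfloor>, \<lfloor>(c u $ 2 - c v $ 2) / (7 / 5)\<rfloor>)" for u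
    have B_verts: "B \<subseteq> verts G"
      using U(1) by (auto simp: B_def)
    have cell_bound: "cell u \<in> {0..2} \<times> {-3..2}" if "u \<in> B" for u
    proof -
      have uU: "u \<in> U" and uv: "closed_nbhd G v \<inter> closed_nbhd G u \<noteq> {}"
        using that by (auto simp: B_def)
      obtain z where z: "z \<in> closed_nbhd G v" "z \<in> closed_nbhd G u"
        using uv by blast
      have "z \<in> verts G"
        using z(1) v U(1) closed_nbhd_subset_verts by blast
      then have "dist (c z) (c v) \<le> 2" "dist (c z) (c u) \<le> 2"
        using z nbhd uU v U(1) by blast+
      then have "dist (c u) (c v) \<le> 4"
        using dist_triangle3[of "c u" "c v" "c z"] by linarith
      then have "\<bar>(c u - c v) $ i\<bar> \<le> 4" for i
        using component_le_norm_cart[of "c u - c v" i] by (simp add: dist_norm)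
      from this[of 1] this[of 2] show ?thesis
        using v_min[OF uU] unfolding cell_def by (simp add: floor_le_iff le_floor_iff) linarith
    qed
    have same_cell: "dist (c u) (c w) \<le> 2" if "cell u = cell w" for u w
    proof -
      have "\<bar>s - t\<bar> \<le> 7 / 5" if "\<lfloor>(s - r) / (7 / 5)\<rfloor> = \<lfloor>(t - r) / (7 / 5)\<rfloor>" for r s t :: real
      proof -
        have "\<bar>x - y\<bar> < 1" if "\<lfloor>x\<rfloor> = \<lfloor>y\<rfloor>" for x y :: real
          using that by linarith
        from this[OF that] have "\<bar>(s - t) / (7 / 5)\<bar> < 1"
          unfolding diff_divide_distrib by argo
        then show ?thesis by argo
      qed
      then have "\<bar>(c u - c w) $ 1\<bar> \<le> 7 / 5" "\<bar>(c u - c w) $ 2\<bar> \<le> 7 / 5"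
        using that unfolding cell_def by auto
      then have "((c u - c w) $ 1)\<^sup>2 \<le> (7 / 5)\<^sup>2" "((c u - c w) $ 2)\<^sup>2 \<le> (7 / 5)\<^sup>2"
        by (metis abs_le_square_iff abs_of_nonneg divide_nonneg_nonneg zero_le_numeral)+
      moreover have "(norm (c u - c w))\<^sup>2 = ((c u - c w) $ 1)\<^sup>2 + ((c u - c w) $ 2)\<^sup>2"
        unfolding power2_norm_eq_inner by (simp add: inner_vec_def sum_2 power2_eq_square)
      moreover have "(7 / 5)\<^sup>2 + (7 / 5)\<^sup>2 \<le> (2 :: real)\<^sup>2"
        by (simp add: power2_eq_square)
      ultimately have "(norm (c u - c w))\<^sup>2 \<le> 2\<^sup>2"
        by linarith
      then show ?thesis
        unfolding dist_norm by (rule power2_le_imp_le) simp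
    qed
    define D where "D = (\<lambda>k. SOME u. u \<in> B \<and> cell u = k) ` cell ` B"
    have rep: "(SOME u'. u' \<in> B \<and> cell u' = cell u) \<in> B \<and>
        cell (SOME u'. u' \<in> B \<and> cell u' = cell u) = cell u" if "u \<in> B" for u
      using someI[of "\<lambda>u'. u' \<in> B \<and> cell u' = cell u" u] that by blast
    have DB: "D \<subseteq> B"
      using rep by (auto simp: D_def)
    have sub: "cell ` B \<subseteq> {0..2} \<times> {-3..2}"
      using cell_bound by blast
    have "card D \<le> card (cell ` B)"
      unfolding D_def by (intro card_image_le finite_subset[OF sub]) simp
    also have "\<dots> \<le> card ({0..2} \<times> {-3..2} :: (int \<times> int) set)"
      using sub by (intro card_mono) auto
    also have "\<dots> = 18"
      by (simp add: card_cartesian_product)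
    finally have "card D \<le> 18" .
    moreover have "B \<subseteq> (\<Union>d\<in>D. closed_nbhd G d)"
    proof
      fix u assume u: "u \<in> B"
      then obtain d where d: "d \<in> D" "cell d = cell u"
        using rep by (auto simp: D_def)
      then have "u \<in> closed_nbhd G d"
        using nbhd[of u d] same_cell[of u d] u DB B_verts by auto
      with d(1) show "u \<in> (\<Union>d\<in>D. closed_nbhd G d)" by blast
    qed
    moreover have "D \<subseteq> verts G"
      using DB B_verts by blast
    ultimately show "\<exists>v\<in>U. \<exists>D \<subseteq> verts G. card D \<le> 18 \<and>
        {u \<in> U. closed_nbhd G v \<inter> closed_nbhd G u \<noteq> {}} \<subseteq> (\<Union>d\<in>D. closed_nbhd G d)"
      using v unfolding B_def by blast
  qed
qed

section \<open>The three bounds\<close>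

theorem theorem1p8:
  fixes G :: "('a, 'b) pre_digraph"
  assumes "graph G"
  shows "(asteroidal_triple_free G \<longrightarrow> domination_number G \<le> 3 * packing_number G) \<and>
         (convex_graph G \<longrightarrow> domination_number G \<le> 3 * packing_number G) \<and>
         (unit_disk_graph G \<longrightarrow> domination_number G \<le> 32 * packing_number G)"
proof -
  interpret graph G by (rule assms)
  have "2 * packing_number G \<le> 3 * packing_number G"
    and "18 * packing_number G \<le> 32 * packing_number G" by simp_all
  then show ?thesis
    using asteroidal_triple_free_domination convex_graph_domination unit_disk_graph_domination
    by (meson le_trans)
qed

end
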